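(* Let $N\ge 1$, let $\phi\in C^1((0,+\infty);(0,+\infty))$ satisfy $(\phi(s)s)'>0$ and $l-1\le \frac{(\phi(s)s)'}{\phi(s)}\le m-1$ for all $s>0$, where $1<l\le m$ are real constants, and let $V\in C^1(\mathbb R^N;\mathbb R)$. Let $c\in\mathbb R$ be such that $\mathcal V_c=\{x\in\mathbb R^N: V(x)\le c\}$ is the union of two nonempty sets $\mathcal V_c^-,\mathcal V_c^+$ with $\operatorname{dist}(\mathcal V_c^-,\mathcal V_c^+)>0$, and suppose that there exists $R>0$ such that $\inf_{\Gamma_c}J_c=\inf\{J_c(q): q\in\Gamma_c,\ \|q\|_{L^\infty(\mathbb R;\mathbb R^N)}\le R\}$. Let $q$ be a $c$-connection between $\mathcal V_c^-$ and $\mathcal V_c^+$ with contact times $\alpha,\omega\in\mathbb R$, $\alpha<\omega$. Then there exists a weak solution $q_c\in C^1(\mathbb R;\mathbb R^N)$ of $(\phi(|\dot q|)\dot q)'=\nabla V(q)$ on $\mathbb R$, periodic with period $T=2(\omega-\alpha)$, satisfying $E_{q_c}(t)=G(|\dot q_c(t)|)-V(q_c(t))=-c$ for all $t\in\mathbb R$ and: (a) $q_c=q$ on $[\alpha,\omega]$; (b) $V(q_c(\alpha))=V(q_c(\omega))=c$ and $V(q_c(t))>c$ for every $t\in(\alpha,\omega)$; (c) $q_c(\alpha)\in\mathcal V_c^-$, $q_c(\omega)\in\mathcal V_c^+$, and $\dot q_c(\alpha)=\dot q_c(\omega)=0$; (d) $q_c(\alpha-t)=q_c(\alpha+t)$ and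 $q_c(\omega-t)=q_c(\omega+t)$ for all $t\in\mathbb R$.
   Context: Set $\Phi(s)=\int_0^{|s|}\phi(r)r\,dr$ and $G(s)=\phi(s)s^2-\Phi(s)$ for $s>0$, $G(0)=0$; $\phi(|v|)v$ is read as $0$ when $v=0$. $\operatorname{dist}$ is Euclidean distance. The energy is $E_q(t)=G(|\dot q(t)|)-V(q(t))$. For an interval $I$, $L^\Phi(I;\mathbb R^N)$ is the set of $q\in L^1_{loc}(I;\mathbb R^N)$ with $\int_I\Phi(|q|/\lambda)\,dt<\infty$ for some $\lambda>0$; $W^{1,\Phi}(I;\mathbb R^N)$ is the set of $q\in L^\Phi$ with weak derivative in $L^\Phi$; $W^{1,\Phi}_{loc}(\mathbb R;\mathbb R^N)$ consists of functions whose restriction to every compact interval $I$ lies in $W^{1,\Phi}(I;\mathbb R^N)$ (identified with continuous representatives). $J_c(q)=\int_{\mathbb R}(\Phi(|\dot q|)+V(q)-c)\,dt$; $\Gamma_c$ is the set of $q\in W^{1,\Phi}_{loc}(\mathbb R;\mathbb R^N)$ with $V(q(t))\ge c$ for all $t$ and $\liminf_{t\to-\infty}\operatorname{dist}(q(t),\mathcal V_c^-)=\liminf_{t\to+\infty}\operatorname{dist}(q(t),\mathcal V_c^+)=0$. Let $I=(\alpha,\omega)$, $-\infty\le\alpha<\omega\le+\infty$, with closure $\bar I$ in $\mathbb R$. A function $q:\bar I\to\mathbb R^N$ is a $c$-connection between $\mathcal V_c^-$ and $\mathcal V_c^+$ with contact times $\alpha,\omega$ if $q\in L^\infty(I;\mathbb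 R^N)$ and: (i) $q\in C^1(\bar I;\mathbb R^N)\cap C^2(I;\mathbb R^N)$ and $(\phi(|\dot q|)\dot q)'=\nabla V(q)$ on $I$; (ii) $V(q(t))>c$ and $E_q(t)=-c$ for all $t\in I$; (iii) $\lim_{t\to\alpha^+}\operatorname{dist}(q(t),\mathcal V_c^-)=\lim_{t\to\omega^-}\operatorname{dist}(q(t),\mathcal V_c^+)=0$. A weak solution on $\mathbb R$ is a function $q$ with $\int_{\mathbb R}\big(\phi(|\dot q|)\dot q\cdot\dot\psi+\nabla V(q)\cdot\psi\big)\,dt=0$ for all $\psi\in C_0^\infty(\mathbb R;\mathbb R^N)$. *)

theory Defs
  imports "HOL-Analysis.Analysis" "HOL-Probability.Essential_Supremum"
begin

section \<open>Differentiability classes\<close>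

text \<open>At a boundary point of \<open>S\<close> the velocity is the one-sided derivative; on an open set
  (in particular on \<open>UNIV\<close>) it is the ordinary derivative.\<close>

definition velocity :: "real set \<Rightarrow> (real \<Rightarrow> 'a::real_normed_vector) \<Rightarrow> real \<Rightarrow> 'a" where
  "velocity S f t = vector_derivative f (at t within S)"

definition C1_on :: "real set \<Rightarrow> (real \<Rightarrow> 'a::real_normed_vector) \<Rightarrow> bool" where
  "C1_on S f \<longleftrightarrow> f differentiable_on S \<and> continuous_on S (velocity S f)"

definition C2_on :: "real set \<Rightarrow> (real \<Rightarrow> 'a::real_normed_vector) \<Rightarrow> bool" where
  "C2_on S f \<longleftrightarrow> C1_on S f \<and> C1_on S (velocity S f)"

definition grad :: "('a::real_inner \<Rightarrow> real) \<Rightarrow> 'a \<Rightarrow> 'a" where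
  "grad V x = (THE D. GDERIV V x :> D)"

definition C1_potential :: "('a::real_inner \<Rightarrow> real) \<Rightarrow> bool" where
  "C1_potential V \<longleftrightarrow> (\<forall>x. GDERIV V x :> grad V x) \<and> continuous_on UNIV (grad V)"

text \<open>\<open>C\<^sub>0\<^sup>\<infinity>(U)\<close>; the first conjunct says that all iterated derivatives exist everywhere.\<close>

definition test_functions :: "real set \<Rightarrow> (real \<Rightarrow> 'a::real_normed_vector) set" where
  "test_functions U = {\<psi>. (\<forall>k. (velocity UNIV ^^ k) \<psi> differentiable_on UNIV) \<and>
     (\<exists>K. compact K \<and> K \<subseteq> U \<and> (\<forall>t. t \<notin> K \<longrightarrow> \<psi> t = 0))}"


section \<open>Lebesgue, Orlicz and Orlicz-Sobolev spaces of curves\<close>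

definition Linf_norm :: "real set \<Rightarrow> (real \<Rightarrow> 'a::euclidean_space) \<Rightarrow> ereal" where
  "Linf_norm I q = esssup (restrict_space lebesgue I) (\<lambda>t. ereal (norm (q t)))"

definition Linf :: "real set \<Rightarrow> (real \<Rightarrow> 'a::euclidean_space) set" where
  "Linf I = {q. q \<in> borel_measurable (restrict_space lebesgue I) \<and> Linf_norm I q < \<infinity>}"

definition L1_loc :: "real set \<Rightarrow> (real \<Rightarrow> 'a::euclidean_space) set" where
  "L1_loc I = {q. \<forall>K. compact K \<and> K \<subseteq> I \<longrightarrow> q absolutely_integrable_on K}"

definition has_weak_deriv ::
    "real set \<Rightarrow> (real \<Rightarrow> 'a::euclidean_space) \<Rightarrow> (real \<Rightarrow> 'a) \<Rightarrow> bool" where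
  "has_weak_deriv I q p \<longleftrightarrow> q \<in> L1_loc I \<and> p \<in> L1_loc I \<and>
     (\<forall>\<psi> \<in> test_functions (interior I).
        (LINT t:I|lebesgue. deriv \<psi> t *\<^sub>R q t) = - (LINT t:I|lebesgue. \<psi> t *\<^sub>R p t))"

text \<open>A representative of the weak derivative, which is unique up to null sets.\<close>

definition weak_deriv :: "real set \<Rightarrow> (real \<Rightarrow> 'a::euclidean_space) \<Rightarrow> real \<Rightarrow> 'a" where
  "weak_deriv I q = (SOME p. has_weak_deriv I q p)"

definition Phi :: "(real \<Rightarrow> real) \<Rightarrow> real \<Rightarrow> real" where
  "Phi \<phi> s = integral {0..\<bar>s\<bar>} (\<lambda>r. \<phi> r * r)"

definition L_Phi :: "(real \<Rightarrow> real) \<Rightarrow> real set \<Rightarrow> (real \<Rightarrow> 'a::euclidean_space) set" where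
  "L_Phi \<phi> I = {q. q \<in> L1_loc I \<and>
     (\<exists>\<mu>>0. (\<integral>\<^sup>+ t\<in>I. ennreal (Phi \<phi> (norm (q t) / \<mu>)) \<partial>lebesgue) < \<infinity>)}"

definition W1_Phi :: "(real \<Rightarrow> real) \<Rightarrow> real set \<Rightarrow> (real \<Rightarrow> 'a::euclidean_space) set" where
  "W1_Phi \<phi> I = {q. q \<in> L_Phi \<phi> I \<and> (\<exists>p. has_weak_deriv I q p \<and> p \<in> L_Phi \<phi> I)}"

text \<open>Elements are identified with their continuous representatives, hence the continuity.\<close>

definition W1_Phi_loc :: "(real \<Rightarrow> real) \<Rightarrow> (real \<Rightarrow> 'a::euclidean_space) set" where
  "W1_Phi_loc \<phi> = {q. continuous_on UNIV q \<and> (\<forall>a b. a < b \<longrightarrow> q \<in> W1_Phi \<phi> {a..b})}"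


section \<open>The variational problem\<close>

text \<open>The integrand of \<open>J_c\<close> is nonnegative for curves in \<open>Gamma_c\<close>, the only ones at which
  \<open>J_c\<close> is evaluated, so the truncation performed by \<open>ennreal\<close> has no effect there.\<close>

definition J_c :: "(real \<Rightarrow> real) \<Rightarrow> ('a::euclidean_space \<Rightarrow> real) \<Rightarrow> real \<Rightarrow> (real \<Rightarrow> 'a) \<Rightarrow> ennreal" where
  "J_c \<phi> V c q =
     (\<integral>\<^sup>+ t. ennreal (Phi \<phi> (norm (weak_deriv UNIV q t)) + V (q t) - c) \<partial>lebesgue)"

definition Gamma_c :: "(real \<Rightarrow> real) \<Rightarrow> ('a::euclidean_space \<Rightarrow> real) \<Rightarrow> real \<Rightarrow> 'a set \<Rightarrow> 'a set \<Rightarrow>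
    (real \<Rightarrow> 'a) set" where
  "Gamma_c \<phi> V c Vm Vp = {q. q \<in> W1_Phi_loc \<phi> \<and> (\<forall>t. V (q t) \<ge> c) \<and>
     Liminf at_bot (\<lambda>t. ereal (infdist (q t) Vm)) = 0 \<and>
     Liminf at_top (\<lambda>t. ereal (infdist (q t) Vp)) = 0}"


section \<open>Energy, connections and weak solutions\<close>

definition G :: "(real \<Rightarrow> real) \<Rightarrow> real \<Rightarrow> real" where
  "G \<phi> s = (if s > 0 then \<phi> s * s\<^sup>2 - Phi \<phi> s else 0)"

definition energy :: "(real \<Rightarrow> real) \<Rightarrow> ('a::euclidean_space \<Rightarrow> real) \<Rightarrow> real set \<Rightarrow>
    (real \<Rightarrow> 'a) \<Rightarrow> real \<Rightarrow> real" where
  "energy \<phi> V S q t = G \<phi> (norm (velocity S q t)) - V (q t)"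

text \<open>The convention \<open>\<phi>(|v|)v = 0\<close> for \<open>v = 0\<close> holds automatically, whatever \<open>\<phi> 0\<close> is.\<close>

definition flux :: "(real \<Rightarrow> real) \<Rightarrow> 'a::real_normed_vector \<Rightarrow> 'a" where
  "flux \<phi> v = \<phi> (norm v) *\<^sub>R v"

text \<open>Contact times are extended reals; the one-sided limits are taken in \<open>ereal\<close>, so that
  \<open>at_right (-\<infinity>)\<close> and \<open>at_left \<infinity>\<close> are the limits at minus and plus infinity.
  Only the values of \<open>q\<close> on the closure of the interval matter.\<close>

definition c_connection :: "(real \<Rightarrow> real) \<Rightarrow> ('a::euclidean_space \<Rightarrow> real) \<Rightarrow> real \<Rightarrow>
    'a set \<Rightarrow> 'a set \<Rightarrow> ereal \<Rightarrow> ereal \<Rightarrow> (real \<Rightarrow> 'a) \<Rightarrow> bool" where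
  "c_connection \<phi> V c Vm Vp \<alpha> \<omega> q \<longleftrightarrow> \<alpha> < \<omega> \<and>
     (let I = einterval \<alpha> \<omega>; v = velocity (closure I) q in
       q \<in> Linf I \<and>
       C1_on (closure I) q \<and> C2_on I q \<and>
       (\<forall>t\<in>I. ((\<lambda>s. flux \<phi> (v s)) has_vector_derivative grad V (q t)) (at t)) \<and>
       (\<forall>t\<in>I. V (q t) > c \<and> energy \<phi> V (closure I) q t = - c) \<and>
       ((\<lambda>t. infdist (q (real_of_ereal t)) Vm) \<longlongrightarrow> 0) (at_right \<alpha>) \<and>
       ((\<lambda>t. infdist (q (real_of_ereal t)) Vp) \<longlongrightarrow> 0) (at_left \<omega>))"

text \<open>Weak solutions on the whole line, with classical derivative; intended for \<open>C\<^sup>1\<close> curves.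
  \<open>has_bochner_integral\<close> states integrability along with the value of the integral.\<close>

definition weak_solution :: "(real \<Rightarrow> real) \<Rightarrow> ('a::euclidean_space \<Rightarrow> real) \<Rightarrow> (real \<Rightarrow> 'a) \<Rightarrow> bool" where
  "weak_solution \<phi> V q \<longleftrightarrow> (\<forall>\<psi> \<in> test_functions UNIV.
     has_bochner_integral lebesgue
       (\<lambda>t. flux \<phi> (velocity UNIV q t) \<bullet> velocity UNIV \<psi> t + grad V (q t) \<bullet> \<psi> t) 0)"

end

theory Submission
  imports Defs
begin

text \<open>The energy identity forces the velocity of the connection to vanish at the two contact points,
  where \<open>V = c\<close>. Hence its periodic continuation by reflection in the endpoints is \<open>C\<^sup>1\<close>, and the
  flux \<open>\<phi>(|q'|)q'\<close> of the continuation is continuous because the growth bound with \<open>l > 1\<close> makes it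
  vanish at zero velocity. Away from the reflected contact times the equation holds classically,
  since it is invariant under time reversal, so integrating by parts across the corners produces
  no boundary terms.\<close>

section \<open>Reflection of an interval\<close>

text \<open>\<open>arccos \<circ> cos\<close> is the triangle wave, so \<open>reflect a b\<close> retracts the line onto \<open>{a..b}\<close> by repeated
  reflection in the endpoints, and \<open>reflect_sign a b\<close> is its slope away from the corners, where it
  is \<open>0\<close>.\<close>

definition reflect :: "real \<Rightarrow> real \<Rightarrow> real \<Rightarrow> real" where
  "reflect a b t = a + (b - a) / pi * arccos (cos (pi * (t - a) / (b - a)))"

definition reflect_sign :: "real \<Rightarrow> real \<Rightarrow> real \<Rightarrow> real" where
  "reflect_sign a b t = sgn (sin (pi * (t - a) / (b - a)))"

section \<open>The triangle wave\<close>

lemma arccos_cos_le_abs: "arccos (cos x) \<le> \<bar>x\<bar>"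
proof (cases "\<bar>x\<bar> \<le> pi")
  case True
  then show ?thesis by (simp add: arccos_cos_eq_abs)
next
  case False
  have "arccos (cos x) \<le> pi" by (simp add: arccos_ubound)
  with False show ?thesis by simp
qed

text \<open>A zero \<open>y\<close> of the sine is a corner of the wave, with \<open>cos y\<close>
  equal to 1 or -1. The addition formula then gives \<open>cos x\<close> as plus or minus
  \<open>cos (x - y)\<close>, and \<open>arccos (- u) = pi - arccos u\<close> makes the difference
  of the two values equal to \<open>arccos (cos (x - y))\<close> up to sign.\<close>

lemma arccos_cos_dist_le:
  assumes "sin y = 0"
  shows "\<bar>arccos (cos x) - arccos (cos y)\<bar> \<le> \<bar>x - y\<bar>"
proof -
  have bounds: "0 \<le> arccos (cos (x - y))" by (simp add: arccos_lbound)
  have "cos x = cos ((x - y) + y)" by simp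
  also have "\<dots> = cos (x - y) * cos y" unfolding cos_add using assms by simp
  finally have x: "cos x = cos (x - y) * cos y" .
  have "(cos y)\<^sup>2 = 1" using sin_cos_squared_add[of y] assms by simp
  then consider "cos y = 1" | "cos y = -1" by (auto simp: power2_eq_1_iff)
  then show ?thesis
    using arccos_cos_le_abs[of "x - y"] bounds x by cases (auto simp: arccos_minus)
qed

lemma abs_cos_less_one:
  fixes x :: real
  assumes "sin x \<noteq> 0"
  shows "\<bar>cos x\<bar> < 1"
proof -
  have "(cos x)\<^sup>2 < 1" using assms by (simp add: cos_squared_eq)
  then show ?thesis by (simp add: abs_square_less_1)
qed

lemma arccos_cos_has_real_derivative:
  assumes "sin x \<noteq> 0"
  shows "((\<lambda>x. arccos (cos x)) has_real_derivative sgn (sin x)) (at x)"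
proof -
  have *: "-1 < cos x" "cos x < 1" using abs_cos_less_one[OF assms] by linarith+
  have "sqrt (1 - (cos x)\<^sup>2) = \<bar>sin x\<bar>" by (simp flip: sin_squared_eq)
  then have "inverse (- sqrt (1 - (cos x)\<^sup>2)) * - sin x = sgn (sin x)"
    using assms by (simp add: sgn_if)
  with DERIV_chain2[OF DERIV_arccos[OF *] DERIV_cos] show ?thesis by simp
qed

lemma reflect_left: "reflect a b (a - t) = reflect a b (a + t)"
  by (simp add: reflect_def)

context
  fixes a b :: real
  assumes ab: "a < b"
begin

lemma reflect_in: "reflect a b t \<in> {a..b}"
proof -
  have *: "0 \<le> arccos (cos x)" "arccos (cos x) / pi \<le> 1" for x :: real
    by (simp_all add: arccos_lbound arccos_ubound)
  show ?thesis
    unfolding reflect_def using ab *[of "pi * (t - a) / (b - a)"]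
      mult_left_mono[OF *(2)[of "pi * (t - a) / (b - a)"], of "b - a"]
    by simp
qed

lemma reflect_of_mem:
  assumes "t \<in> {a..b}"
  shows "reflect a b t = t"
proof -
  have "0 \<le> pi * (t - a) / (b - a)" "pi * (t - a) / (b - a) \<le> pi"
    using assms ab by (auto simp: divide_simps)
  then show ?thesis
    using ab by (simp add: reflect_def arccos_cos field_simps)
qed

lemma reflect_periodic: "reflect a b (t + 2 * (b - a)) = reflect a b t"
proof -
  have "pi * (t + 2 * (b - a) - a) / (b - a) = pi * (t - a) / (b - a) + 2 * pi"
    using ab by (simp add: divide_simps) (simp add: algebra_simps)
  then show ?thesis by (simp add: reflect_def)
qed

text \<open>Reflection in \<open>b\<close> is reflection in \<open>a\<close> followed by a shift by
  the period \<open>2 * (b - a)\<close>.\<close>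

lemma reflect_right: "reflect a b (b - t) = reflect a b (b + t)"
proof -
  have "reflect a b (b - t) = reflect a b (a - (a - b + t))" by simp
  also have "\<dots> = reflect a b (2 * a - b + t)" 
    by (subst reflect_left) (simp add: algebra_simps)
  also have "\<dots> = reflect a b (b + t)" using reflect_periodic[of "2 * a - b + t"] by simp
  finally show ?thesis .
qed

text \<open>Basic dichotomy for all later arguments: a corner is sent to an endpoint, and any other
  time to the open interval, because there the cosine lies strictly between -1 and 1.\<close>

lemma reflect_sign_cases:
  obtains "reflect_sign a b t = 0" "reflect a b t \<in> {a, b}"
  | "\<bar>reflect_sign a b t\<bar> = 1" "reflect a b t \<in> {a<..<b}"
proof -
  define x where "x = pi * (t - a) / (b - a)"
  have r: "reflect a b t = a + (b - a) / pi * arccos (cos x)"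
    "reflect_sign a b t = sgn (sin x)" by (simp_all add: reflect_def reflect_sign_def x_def)
  show thesis
  proof (cases "sin x = 0")
    case True
    then have "(cos x)\<^sup>2 = 1" using sin_cos_squared_add[of x] by simp
    then have "cos x = 1 \<or> cos x = -1" by (simp add: power2_eq_1_iff)
    with True that(1) show thesis by (auto simp: r)
  next
    case False
    have "reflect a b t \<noteq> a" "reflect a b t \<noteq> b"
    proof -
      have "cos x \<noteq> 1" "cos x \<noteq> -1" using abs_cos_less_one[OF False] by auto
      then have "arccos (cos x) \<noteq> 0" "arccos (cos x) \<noteq> pi"
        using cos_arccos_abs[of "cos x"] by (metis abs_cos_le_one cos_zero cos_pi)+
      moreover have "reflect a b t = b + (b - a) / pi * (arccos (cos x) - pi)"
        by (simp add: r right_diff_distrib)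
      ultimately show "reflect a b t \<noteq> a" "reflect a b t \<noteq> b"
        using ab by (auto simp: r(1))
    qed
    with reflect_in[of t] have "reflect a b t \<in> {a<..<b}" by auto
    with False that(2) show thesis by (simp add: r abs_sgn_eq)
  qed
qed

section \<open>Calculus through the reflection\<close>

lemma reflect_has_real_derivative:
  assumes "reflect_sign a b t \<noteq> 0"
  shows "(reflect a b has_real_derivative reflect_sign a b t) (at t)"
proof -
  let ?x = "\<lambda>s. pi * (s - a) / (b - a)"
  have "sin (?x t) \<noteq> 0" using assms by (simp add: reflect_sign_def sgn_zero_iff)
  note arccos_cos_has_real_derivative[OF this]
  moreover have "(?x has_real_derivative pi / (b - a)) (at t)"
    using ab by (auto intro!: derivative_eq_intros)
  ultimately have "((\<lambda>s. arccos (cos (?x s))) has_real_derivative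
      reflect_sign a b t * (pi / (b - a))) (at t)"
    unfolding reflect_sign_def by (rule DERIV_chain2)
  from DERIV_add[OF DERIV_const DERIV_cmult[OF this, of "(b - a) / pi"], of a] show ?thesis
    unfolding reflect_def[abs_def] using ab by simp
qed

text \<open>Lipschitz bound with constant 1 at a corner, where it takes the place of the chain
  rule.\<close>

lemma reflect_dist_le:
  assumes "reflect_sign a b t = 0"
  shows "\<bar>reflect a b s - reflect a b t\<bar> \<le> \<bar>s - t\<bar>"
proof -
  let ?x = "\<lambda>s. pi * (s - a) / (b - a)"
  have "\<bar>reflect a b s - reflect a b t\<bar>
      = (b - a) / pi * \<bar>arccos (cos (?x s)) - arccos (cos (?x t))\<bar>"
    using ab unfolding reflect_def add_diff_cancel_left right_diff_distrib[symmetric] abs_mult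
    by simp
  also have "\<dots> \<le> (b - a) / pi * \<bar>?x s - ?x t\<bar>"
    using assms ab by (intro mult_left_mono arccos_cos_dist_le) (auto simp: reflect_sign_def sgn_zero_iff)
  also have "?x s - ?x t = pi / (b - a) * (s - t)"
    by (simp add: algebra_simps flip: diff_divide_distrib)
  finally show ?thesis using ab by (simp add: abs_mult)
qed

lemma continuous_reflect: "continuous_on UNIV (reflect a b)"
  unfolding reflect_def[abs_def] using ab by (auto intro!: continuous_intros)

text \<open>A continuous function keeps its sign near a point where it is nonzero.\<close>

lemma eventually_reflect_sign:
  assumes "reflect_sign a b t \<noteq> 0"
  shows "\<forall>\<^sub>F s in nhds t. reflect_sign a b s = reflect_sign a b t"
proof -
  let ?f = "\<lambda>s. sin (pi * (s - a) / (b - a))"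
  have lim: "(?f \<longlongrightarrow> ?f t) (nhds t)"
    using ab by (intro tendsto_intros filterlim_ident) auto
  show ?thesis
  proof (cases "?f t > 0")
    case True
    then show ?thesis
      using order_tendstoD(1)[OF lim True] by (auto simp: reflect_sign_def elim: eventually_mono)
  next
    case False
    then have neg: "?f t < 0" using assms by (auto simp: reflect_sign_def sgn_zero_iff not_less)
    then show ?thesis
      using order_tendstoD(2)[OF lim neg] by (auto simp: reflect_sign_def elim: eventually_mono)
  qed
qed

lemma finite_reflect_corners: "finite {t \<in> {u..w}. reflect_sign a b t = 0}"
proof (rule finite_subset)
  \<comment> \<open>A corner is \<open>a + k * (b - a)\<close> for an integer \<open>k\<close>, and
    \<open>\<bar>t - a\<bar>\<close> is at most the numerator for \<open>t\<close> in
    \<open>{u..w}\<close>, so \<open>?n\<close> bounds \<open>\<bar>k\<bar>\<close>.\<close>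
  let ?n = "\<lceil>(\<bar>u\<bar> + \<bar>w\<bar> + \<bar>a\<bar>) / (b - a)\<rceil>"
  show "finite ((\<lambda>k. a + of_int k * (b - a)) ` {-?n..?n})" by simp
  show "{t \<in> {u..w}. reflect_sign a b t = 0} \<subseteq> (\<lambda>k. a + of_int k * (b - a)) ` {-?n..?n}"
  proof safe
    fix t assume t: "t \<in> {u..w}" "reflect_sign a b t = 0"
    then obtain k :: int where "pi * (t - a) / (b - a) = of_int k * pi"
      by (auto simp: reflect_sign_def sgn_zero_iff sin_zero_iff_int2)
    then have "pi * (t - a) = pi * (of_int k * (b - a))" using ab by (simp add: divide_simps)
    then have k: "t = a + of_int k * (b - a)" by simp
    have "\<bar>of_int k\<bar> * (b - a) = \<bar>t - a\<bar>" using ab by (simp add: k abs_mult)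
    also have "\<dots> \<le> \<bar>u\<bar> + \<bar>w\<bar> + \<bar>a\<bar>" using t by auto
    finally have "\<bar>of_int k\<bar> \<le> (\<bar>u\<bar> + \<bar>w\<bar> + \<bar>a\<bar>) / (b - a)" using ab by (simp add: field_simps)
    then have "\<bar>k\<bar> \<le> ?n" by linarith
    then have "k \<in> {-?n..?n}" by auto
    with k show "t \<in> (\<lambda>k. a + of_int k * (b - a)) ` {-?n..?n}" by blast
  qed
qed

lemma reflect_comp_has_vector_derivative:
  fixes f :: "real \<Rightarrow> 'a::real_normed_vector"
  assumes "reflect_sign a b t \<noteq> 0" "(f has_vector_derivative v) (at (reflect a b t))"
  shows "((\<lambda>s. f (reflect a b s)) has_vector_derivative reflect_sign a b t *\<^sub>R v) (at t)"
  using vector_diff_chain_at[OF reflect_has_real_derivative[OF assms(1),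
        unfolded has_real_derivative_iff_has_vector_derivative] assms(2)]
  by (simp add: comp_def)

text \<open>With one-sided derivative 0, the increment of \<open>f\<close> is small compared with
  that of \<open>reflect a b\<close>, which \<open>reflect_dist_le\<close> bounds by
  \<open>\<bar>s - t\<bar>\<close>. This removes the kink.\<close>

lemma reflect_comp_has_vector_derivative_corner:
  fixes f :: "real \<Rightarrow> 'a::real_normed_vector"
  assumes "reflect_sign a b t = 0"
    "(f has_vector_derivative 0) (at (reflect a b t) within {a..b})"
  shows "((\<lambda>s. f (reflect a b s)) has_vector_derivative 0) (at t)"
  unfolding has_vector_derivative_def has_derivative_at_alt
proof (intro conjI allI impI)
  fix e :: real assume "e > 0"
  with assms(2) obtain d where d: "d > 0"
    "\<And>y. y \<in> {a..b} \<Longrightarrow> \<bar>y - reflect a b t\<bar> < d \<Longrightarrow>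
      norm (f y - f (reflect a b t)) \<le> e * \<bar>y - reflect a b t\<bar>"
    unfolding has_vector_derivative_def has_derivative_within_alt by fastforce
  have "norm (f (reflect a b s) - f (reflect a b t)) \<le> e * \<bar>s - t\<bar>" if "\<bar>s - t\<bar> < d" for s
  proof -
    have "norm (f (reflect a b s) - f (reflect a b t)) \<le> e * \<bar>reflect a b s - reflect a b t\<bar>"
      using d(2)[OF reflect_in, of s] reflect_dist_le[OF assms(1), of s] that by simp
    also have "\<dots> \<le> e * \<bar>s - t\<bar>"
      using \<open>e > 0\<close> reflect_dist_le[OF assms(1), of s] by simp
    finally show ?thesis .
  qed
  with \<open>d > 0\<close> show "\<exists>d>0. \<forall>y. norm (y - t) < d \<longrightarrow>
      norm (f (reflect a b y) - f (reflect a b t) - (y - t) *\<^sub>R 0) \<le> e * norm (y - t)"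
    by auto
qed simp

text \<open>The sign jumps only at corners, where the other factor tends to 0 and the sign stays
  bounded by 1.\<close>

lemma continuous_reflect_sign_scaleR:
  fixes v :: "real \<Rightarrow> 'a::real_normed_vector"
  assumes v: "continuous_on {a..b} v" and "v a = 0" "v b = 0"
  shows "continuous_on UNIV (\<lambda>t. reflect_sign a b t *\<^sub>R v (reflect a b t))"
proof -
  have cont: "continuous_on UNIV (\<lambda>t. v (reflect a b t))"
    by (rule continuous_on_compose2[OF v continuous_reflect]) (use reflect_in in auto)
  then have lim: "((\<lambda>s. v (reflect a b s)) \<longlongrightarrow> v (reflect a b t)) (at t)" for t
    by (simp add: continuous_on_def)
  have "((\<lambda>s. reflect_sign a b s *\<^sub>R v (reflect a b s)) \<longlongrightarrow>
      reflect_sign a b t *\<^sub>R v (reflect a b t)) (at t)" for t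
  proof (cases rule: reflect_sign_cases[of t])
    case 1
    then have "v (reflect a b t) = 0" using assms by auto
    with lim[of t] have "((\<lambda>s. norm (v (reflect a b s))) \<longlongrightarrow> 0) (at t)"
      by (simp add: tendsto_norm_zero_iff)
    then have "((\<lambda>s. reflect_sign a b s *\<^sub>R v (reflect a b s)) \<longlongrightarrow> 0) (at t)"
      by (rule Lim_null_comparison[rotated])
        (simp add: reflect_sign_def mult_left_le_one_le abs_sgn_eq)
    with 1 show ?thesis by simp
  next
    case 2
    then have "reflect_sign a b t \<noteq> 0" by auto
    then have "\<forall>\<^sub>F s in at t. reflect_sign a b s = reflect_sign a b t"
      unfolding eventually_at_filter by (auto intro: eventually_mono[OF eventually_reflect_sign])
    then have "(reflect_sign a b \<longlongrightarrow> reflect_sign a b t) (at t)"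
      by (rule tendsto_eventually)
    with lim show ?thesis by (intro tendsto_scaleR)
  qed
  then show ?thesis by (simp add: continuous_on_def)
qed

end

section \<open>The flux and the function \<open>G\<close>\<close>

lemma C1_potential_continuous:
  assumes "C1_potential V"
  shows "continuous_on UNIV V"
  using assms unfolding C1_potential_def gderiv_def
  by (intro continuous_at_imp_continuous_on ballI has_derivative_continuous) blast

text \<open>The scalar \<open>\<phi> r * r\<close> is the size of the flux at speed
  \<open>r\<close>; \<open>deriv_ge\<close> is the lower growth bound cleared of its
  denominator.\<close>

locale phi_function =
  fixes \<phi> :: "real \<Rightarrow> real" and l :: real
  assumes phi_differentiable: "\<phi> differentiable_on {0<..}"
    and phi_pos: "s > 0 \<Longrightarrow> \<phi> s > 0"
    and l_gt_1: "1 < l"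
    and deriv_ge: "s > 0 \<Longrightarrow> (l - 1) * \<phi> s \<le> deriv (\<lambda>r. \<phi> r * r) s"
begin

lemma DERIV_flux:
  assumes "s > 0"
  shows "((\<lambda>r. \<phi> r * r) has_real_derivative deriv (\<lambda>r. \<phi> r * r) s) (at s)"
proof -
  have "\<phi> differentiable at s"
    using phi_differentiable assms by (simp add: differentiable_on_eq_differentiable_at)
  then show ?thesis
    by (intro DERIV_deriv_iff_real_differentiable[THEN iffD2] differentiable_mult) auto
qed

lemma flux_mono:
  assumes "0 \<le> s" "s \<le> t"
  shows "\<phi> s * s \<le> \<phi> t * t"
proof (cases "s = 0")
  case True
  then show ?thesis using assms phi_pos[of t] by (cases "t = 0") auto
next
  case False
  show ?thesis
  proof (rule DERIV_nonneg_imp_nondecreasing[OF \<open>s \<le> t\<close>])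
    fix x assume "s \<le> x"
    with False assms have "x > 0" by simp
    with DERIV_flux deriv_ge[of x] phi_pos[of x] l_gt_1
    show "\<exists>y. ((\<lambda>r. \<phi> r * r) has_real_derivative y) (at x) \<and> 0 \<le> y"
      by (meson diff_gt_0_iff_gt less_imp_le mult_nonneg_nonneg order_trans)
  qed
qed

text \<open>The lower growth bound says that \<open>\<phi> s * s / s powr (l - 1)\<close> is nondecreasing.\<close>

lemma flux_le_powr:
  assumes "0 < s" "s \<le> 1"
  shows "\<phi> s * s \<le> \<phi> 1 * s powr (l - 1)"
proof -
  have "\<phi> s * s * s powr (1 - l) \<le> \<phi> 1 * 1 * 1 powr (1 - l)"
  proof (rule DERIV_nonneg_imp_nondecreasing[OF \<open>s \<le> 1\<close>])
    fix x assume "s \<le> x"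
    with assms have x: "x > 0" by simp
    let ?D = "deriv (\<lambda>r. \<phi> r * r) x"
    have "((\<lambda>r. \<phi> r * r * r powr (1 - l)) has_real_derivative
        ?D * x powr (1 - l) + (1 - l) * x powr (1 - l - 1) * (\<phi> x * x)) (at x)"
      using DERIV_mult[OF DERIV_flux[OF x] has_real_derivative_powr[OF x, of "1 - l"]]
      by (simp add: mult.commute)
    \<comment> \<open>The factor \<open>x\<close> of the flux restores the exponent
      \<open>1 - l\<close>, so both terms of the derivative share
      \<open>x powr (1 - l)\<close>.\<close>
    moreover have "x powr (1 - l - 1) * x = x powr (1 - l)"
      using powr_add[of x "1 - l - 1" 1] x by simp
    then have "(1 - l) * x powr (1 - l - 1) * (\<phi> x * x) = (1 - l) * \<phi> x * x powr (1 - l)"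
      by (metis mult.assoc mult.commute)
    then have "?D * x powr (1 - l) + (1 - l) * x powr (1 - l - 1) * (\<phi> x * x)
        = (?D - (l - 1) * \<phi> x) * x powr (1 - l)"
      by (simp add: left_diff_distrib distrib_right)
    moreover have "0 \<le> \<dots>" using deriv_ge[OF x] by simp
    ultimately show "\<exists>y. ((\<lambda>r. \<phi> r * r * r powr (1 - l)) has_real_derivative y) (at x) \<and> 0 \<le> y"
      by metis
  qed
  then have "\<phi> s * s * s powr (1 - l) * s powr (l - 1) \<le> \<phi> 1 * s powr (l - 1)"
    by (intro mult_right_mono) auto
  with assms show ?thesis by (simp add: mult.assoc flip: powr_add)
qed

text \<open>Only the origin is delicate, since \<phi> may blow up there: \<open>flux_le_powr\<close>
  bounds the norm by a multiple of \<open>norm u powr (l - 1)\<close>, which tends to 0 because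
  \<open>l > 1\<close>.\<close>

lemma continuous_flux: "continuous_on UNIV (flux \<phi> :: 'a::real_normed_vector \<Rightarrow> 'a)"
proof -
  have "(flux \<phi> \<longlongrightarrow> flux \<phi> v) (at v)" for v :: 'a
  proof (cases "v = 0")
    case True
    have "((\<lambda>u::'a. \<phi> 1 * norm u powr (l - 1)) \<longlongrightarrow> \<phi> 1 * 0) (at 0)"
      by (intro tendsto_mult_left tendsto_zero_powrI tendsto_const tendsto_norm_zero tendsto_ident_at)
        (use l_gt_1 in auto)
    moreover have "\<forall>\<^sub>F u::'a in at 0. norm (flux \<phi> u) \<le> \<phi> 1 * norm u powr (l - 1)"
      unfolding eventually_at
    proof (intro exI[of _ 1] conjI ballI impI)
      fix u :: 'a assume "u \<noteq> 0 \<and> dist u 0 < 1"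
      then show "norm (flux \<phi> u) \<le> \<phi> 1 * norm u powr (l - 1)"
        using flux_le_powr[of "norm u"] phi_pos[of "norm u"] by (simp add: flux_def)
    qed simp
    ultimately have "(flux \<phi> \<longlongrightarrow> (0::'a)) (at 0)"
      by (simp add: Lim_null_comparison)
    with True show ?thesis by (simp add: flux_def)
  next
    case False
    then have "isCont \<phi> (norm v)"
      using phi_differentiable differentiable_imp_continuous_on continuous_on_eq_continuous_at
      by (metis greaterThan_iff open_greaterThan zero_less_norm_iff)
    then show ?thesis unfolding flux_def
      by (intro tendsto_intros isCont_tendsto_compose[of "norm v" \<phi>])
  qed
  then show ?thesis by (simp add: continuous_on_def)
qed

text \<open>Monotonicity gives integrability down to 0 without any control of \<phi> there.\<close>

lemma flux_integrable: "(\<lambda>r. \<phi> r * r) integrable_on {a..b}" if "0 \<le> a"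
  by (rule integrable_on_mono_on) (use flux_mono that in \<open>auto simp: mono_on_def\<close>)

section \<open>Monotonicity and positivity of \<open>G\<close>\<close>

lemma G_eq: "s > 0 \<Longrightarrow> G \<phi> s = s * (\<phi> s * s) - integral {0..s} (\<lambda>r. \<phi> r * r)"
  by (simp add: G_def Phi_def power2_eq_square mult_ac)

text \<open>With \<open>f r = \<phi> r * r\<close> nondecreasing, \<open>t * f t - s * f s\<close>
  is at least \<open>(t - s) * f t\<close>, which dominates the integral of \<open>f\<close> over
  \<open>{s..t}\<close>.\<close>

lemma G_mono:
  assumes "0 < s" "s \<le> t"
  shows "G \<phi> s \<le> G \<phi> t"
proof -
  have "integral {0..s} (\<lambda>r. \<phi> r * r) + integral {s..t} (\<lambda>r. \<phi> r * r)
      = integral {0..t} (\<lambda>r. \<phi> r * r)"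
    using assms by (intro Henstock_Kurzweil_Integration.integral_combine flux_integrable) auto
  moreover have "integral {s..t} (\<lambda>r. \<phi> r * r) \<le> integral {s..t} (\<lambda>r. \<phi> t * t)"
    using assms by (intro integral_le flux_integrable flux_mono) auto
  then have "integral {s..t} (\<lambda>r. \<phi> r * r) \<le> t * (\<phi> t * t) - s * (\<phi> t * t)"
    using assms by (simp add: algebra_simps)
  moreover have "s * (\<phi> s * s) \<le> s * (\<phi> t * t)"
    using assms by (intro mult_left_mono flux_mono) auto
  ultimately show ?thesis using assms G_eq[of s] G_eq[of t] by linarith
qed

text \<open>Cut \<open>{0..s}\<close> at its midpoint \<open>h\<close>. The flux on the left half is
  at most its value at \<open>h\<close>, strictly below its value at \<open>s\<close>, so the
  integral is strictly less than \<open>s * (\<phi> s * s)\<close>.\<close>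

lemma G_pos:
  assumes "0 < s"
  shows "G \<phi> s > 0"
proof -
  define h where "h = s / 2"
  have h: "0 < h" "h < s" "s - h = h" "s = h + h" using assms by (auto simp: h_def)
  have "\<phi> h * h < \<phi> s * s"
  proof (rule DERIV_pos_imp_increasing[of h s "\<lambda>r. \<phi> r * r"])
    fix x assume "h \<le> x"
    with h have "x > 0" by simp
    with DERIV_flux deriv_ge[of x] phi_pos[of x] l_gt_1
    show "\<exists>y. ((\<lambda>r. \<phi> r * r) has_real_derivative y) (at x) \<and> 0 < y"
      by (meson diff_gt_0_iff_gt less_le_trans mult_pos_pos)
  qed (use h in simp)
  then have "h * (\<phi> h * h) < h * (\<phi> s * s)" using h by simp
  moreover have "integral {0..h} (\<lambda>r. \<phi> r * r) + integral {h..s} (\<lambda>r. \<phi> r * r)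
      = integral {0..s} (\<lambda>r. \<phi> r * r)"
    using h by (intro Henstock_Kurzweil_Integration.integral_combine flux_integrable) auto
  moreover have "integral {0..h} (\<lambda>r. \<phi> r * r) \<le> integral {0..h} (\<lambda>r. \<phi> h * h)"
    using h by (intro integral_le flux_integrable flux_mono) auto
  then have "integral {0..h} (\<lambda>r. \<phi> r * r) \<le> h * (\<phi> h * h)"
    using h(1) by (simp add: mult_ac)
  moreover have "integral {h..s} (\<lambda>r. \<phi> r * r) \<le> integral {h..s} (\<lambda>r. \<phi> s * s)"
    using h by (intro integral_le flux_integrable flux_mono) auto
  then have "integral {h..s} (\<lambda>r. \<phi> r * r) \<le> h * (\<phi> s * s)"
    using h(2,3) by (simp add: mult_ac)
  moreover have "G \<phi> s = h * (\<phi> s * s) + h * (\<phi> s * s) - integral {0..s} (\<lambda>r. \<phi> r * r)"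
    using G_eq[OF assms] h(4) by (metis distrib_right)
  ultimately show ?thesis by linarith
qed

text \<open>Monotonicity of \<open>G\<close> replaces its continuity here.\<close>

lemma eq_zero_of_G_tendsto_zero:
  fixes v :: "'b \<Rightarrow> 'a::real_normed_vector"
  assumes "(v \<longlongrightarrow> v0) F" "((\<lambda>t. G \<phi> (norm (v t))) \<longlongrightarrow> 0) F" "F \<noteq> bot"
  shows "v0 = 0"
proof (rule ccontr)
  assume "v0 \<noteq> 0"
  then have pos: "norm v0 / 2 > 0" "norm v0 / 2 < norm v0" by auto
  have "\<forall>\<^sub>F t in F. norm v0 / 2 < norm (v t)"
    using order_tendstoD(1)[OF tendsto_norm[OF assms(1)] pos(2)] .
  then have "\<forall>\<^sub>F t in F. G \<phi> (norm v0 / 2) \<le> G \<phi> (norm (v t))"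
    by eventually_elim (use pos in \<open>auto intro: G_mono\<close>)
  then have "G \<phi> (norm v0 / 2) \<le> 0"
    using assms by (intro tendsto_lowerbound[OF assms(2)])
  with G_pos[OF pos(1)] show False by simp
qed

end

section \<open>Weak solutions\<close>

text \<open>Finitely many exceptional times per bounded interval are harmless since the flux is continuous.\<close>

lemma weak_solution_of_flux_derivative:
  fixes q :: "real \<Rightarrow> 'a::euclidean_space"
  assumes cont_flux: "continuous_on UNIV (\<lambda>t. flux \<phi> (velocity UNIV q t))"
    and cont_grad: "continuous_on UNIV (\<lambda>t. grad V (q t))"
    and deriv: "\<And>t. t \<notin> S \<Longrightarrow>
      ((\<lambda>t. flux \<phi> (velocity UNIV q t)) has_vector_derivative grad V (q t)) (at t)"
    and finite: "\<And>u w. finite ({u..w} \<inter> S)"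
  shows "weak_solution \<phi> V q"
  unfolding weak_solution_def
proof
  fix \<psi> :: "real \<Rightarrow> 'a" assume "\<psi> \<in> test_functions UNIV"
  then obtain K where diff: "\<And>k. (velocity UNIV ^^ k) \<psi> differentiable_on UNIV"
    and K: "compact K" "\<And>t. t \<notin> K \<Longrightarrow> \<psi> t = 0"
    by (auto simp: test_functions_def)
  have d0: "(\<psi> has_vector_derivative velocity UNIV \<psi> t) (at t)" for t
    using diff[of 0] by (simp add: differentiable_on_def velocity_def flip: vector_derivative_works)
  have cont: "continuous_on UNIV \<psi>" "continuous_on UNIV (velocity UNIV \<psi>)"
    using diff[of 0] diff[of 1] by (auto intro: differentiable_imp_continuous_on)
  \<comment> \<open>The radius exceeds a bound of the support by 1, so both endpoints lie outside
    \<open>K\<close> and the boundary terms vanish.\<close>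
  obtain M where M: "K \<subseteq> {-M<..<M}" "M > 0"
  proof -
    obtain B where "B > 0" "\<And>t. t \<in> K \<Longrightarrow> \<bar>t\<bar> \<le> B"
      using compact_imp_bounded[OF K(1)] bounded_pos[of K] by auto
    then show thesis by (intro that[of "B + 1"]) fastforce+
  qed
  have zero: "\<psi> t = 0" "velocity UNIV \<psi> t = 0" if "t \<notin> K" for t
  proof -
    have "open (- K)" using K(1) by (simp add: compact_imp_closed open_Compl)
    then have "(\<psi> has_vector_derivative 0) (at t)"
      by (rule has_vector_derivative_transform_within_open[OF has_vector_derivative_const])
        (use K(2) that in auto)
    then show "velocity UNIV \<psi> t = 0" by (simp add: velocity_def vector_derivative_at)
  qed (use K(2) that in auto)
  let ?F = "\<lambda>t. flux \<phi> (velocity UNIV q t)"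
  let ?f = "\<lambda>t. ?F t \<bullet> velocity UNIV \<psi> t + grad V (q t) \<bullet> \<psi> t"
  have "(?f has_integral (?F M \<bullet> \<psi> M - ?F (-M) \<bullet> \<psi> (-M))) {-M..M}"
  proof (rule fundamental_theorem_of_calculus_strong[OF finite[of "-M" M]])
    fix t assume "t \<in> {-M..M} - {-M..M} \<inter> S"
    then have "t \<notin> S" by auto
    from bounded_bilinear.has_vector_derivative[OF bounded_bilinear_inner deriv[OF this] d0[of t]]
    show "((\<lambda>t. ?F t \<bullet> \<psi> t) has_vector_derivative ?f t) (at t)" .
  next
    show "continuous_on {-M..M} (\<lambda>t. ?F t \<bullet> \<psi> t)"
      using cont cont_flux by (auto intro!: continuous_intros intro: continuous_on_subset)
  qed (use M in auto)
  moreover have "M \<notin> K" "-M \<notin> K" using M by auto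
  then have "\<psi> M = 0" "\<psi> (-M) = 0" using K(2) by blast+
  ultimately have int: "(?f has_integral 0) {-M..M}" by simp
  have "continuous_on UNIV ?f"
    using cont cont_flux cont_grad by (intro continuous_intros)
  \<comment> \<open>Continuity on a compact interval turns the gauge integral into a Lebesgue
    integral; the indicator can then be dropped because the integrand vanishes off
    \<open>K\<close>.\<close>
  then have "?f absolutely_integrable_on {-M..M}"
    by (meson absolutely_integrable_continuous_real continuous_on_subset subset_UNIV)
  moreover from this have "(LINT t:{-M..M}|lebesgue. ?f t) = 0"
    using int by (simp add: set_lebesgue_integral_eq_integral(2) integral_unique)
  moreover have "(\<lambda>t. indicator {-M..M} t *\<^sub>R ?f t) = ?f"
  proof
    fix t show "indicator {-M..M} t *\<^sub>R ?f t = ?f t"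
      using zero[of t] M by (cases "t \<in> K") (auto simp: indicator_def)
  qed
  ultimately show "has_bochner_integral lebesgue ?f 0"
    by (simp add: has_bochner_integral_iff set_integrable_def set_lebesgue_integral_def)
qed

section \<open>Contact points of the sublevel set\<close>

text \<open>The limit lies in \<open>closure A\<close>, hence in the closed union; it cannot lie in
  \<open>B\<close>, which has positive distance from \<open>closure A\<close> as well. Closedness of
  \<open>A\<close> alone is thus never assumed.\<close>

lemma mem_of_infdist_tendsto_zero:
  fixes q :: "'b \<Rightarrow> 'a::euclidean_space"
  assumes closed: "closed (A \<union> B)" and dist: "setdist A B > 0"
    and lim: "((\<lambda>t. infdist (q t) A) \<longlongrightarrow> 0) F" "(q \<longlongrightarrow> x) F" "F \<noteq> bot"
  shows "x \<in> A"
proof -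
  have "A \<noteq> {}" "B \<noteq> {}" using dist by auto
  have "infdist x A = 0"
    using tendsto_unique[OF \<open>F \<noteq> bot\<close> tendsto_infdist[OF lim(2)] lim(1)] .
  then have x: "x \<in> closure A" using \<open>A \<noteq> {}\<close> by (simp add: in_closure_iff_infdist_zero)
  moreover have "closure A \<subseteq> A \<union> B" using closed by (simp add: closure_minimal)
  moreover have "x \<notin> B"
  proof
    assume "x \<in> B"
    then have "setdist (closure A) B \<le> dist x x" using x by (rule setdist_le_dist[rotated])
    with dist show False by simp
  qed
  ultimately show ?thesis by auto
qed

section \<open>The periodic solution\<close>

theorem proposition3p18:
  fixes \<phi> :: "real \<Rightarrow> real" and l m c R \<alpha> \<omega> :: real
    and V :: "real ^ 'n \<Rightarrow> real" and Vm Vp :: "(real ^ 'n) set"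
    and q :: "real \<Rightarrow> real ^ 'n"
  assumes phi_C1: "C1_on {0<..} \<phi>"
    and phi_pos: "\<And>s. s > 0 \<Longrightarrow> \<phi> s > 0"
    and lm: "1 < l" "l \<le> m"
    and phi_mono: "\<And>s. s > 0 \<Longrightarrow> deriv (\<lambda>r. \<phi> r * r) s > 0"
    and phi_growth: "\<And>s. s > 0 \<Longrightarrow> l - 1 \<le> deriv (\<lambda>r. \<phi> r * r) s / \<phi> s \<and>
                                    deriv (\<lambda>r. \<phi> r * r) s / \<phi> s \<le> m - 1"
    and V_C1: "C1_potential V"
    and sublevel: "{x. V x \<le> c} = Vm \<union> Vp"
    and nonempty: "Vm \<noteq> {}" "Vp \<noteq> {}"
    and separated: "setdist Vm Vp > 0"
    and R: "R > 0"
      "(INF p \<in> Gamma_c \<phi> V c Vm Vp. J_c \<phi> V c p) =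
       (INF p \<in> {p \<in> Gamma_c \<phi> V c Vm Vp. Linf_norm UNIV p \<le> ereal R}. J_c \<phi> V c p)"
    and contact: "\<alpha> < \<omega>"
    and conn: "c_connection \<phi> V c Vm Vp (ereal \<alpha>) (ereal \<omega>) q"
  shows "\<exists>qc :: real \<Rightarrow> real ^ 'n.
      C1_on UNIV qc \<and> weak_solution \<phi> V qc \<and>
      (\<forall>t. qc (t + 2 * (\<omega> - \<alpha>)) = qc t) \<and>
      (\<forall>t. energy \<phi> V UNIV qc t = - c) \<and>
      (\<forall>t \<in> {\<alpha>..\<omega>}. qc t = q t) \<and>
      (V (qc \<alpha>) = c \<and> V (qc \<omega>) = c \<and> (\<forall>t \<in> {\<alpha><..<\<omega>}. V (qc t) > c)) \<and>
      (qc \<alpha> \<in> Vm \<and> qc \<omega> \<in> Vp \<and> velocity UNIV qc \<alpha> = 0 \<and> velocity UNIV qc \<omega> = 0) \<and>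
      (\<forall>t. qc (\<alpha> - t) = qc (\<alpha> + t) \<and> qc (\<omega> - t) = qc (\<omega> + t))"
proof -
  interpret phi_function \<phi> l
    using phi_C1 phi_pos lm(1) phi_growth by unfold_locales (auto simp: C1_on_def pos_le_divide_eq)
  let ?\<rho> = "reflect \<alpha> \<omega>" and ?\<sigma> = "reflect_sign \<alpha> \<omega>"
  define v where "v = velocity {\<alpha>..\<omega>} q"
  have q_diff: "q differentiable_on {\<alpha>..\<omega>}" and v_cont: "continuous_on {\<alpha>..\<omega>} v"
    and flux: "\<And>t. t \<in> {\<alpha><..<\<omega>} \<Longrightarrow>
      ((\<lambda>s. flux \<phi> (v s)) has_vector_derivative grad V (q t)) (at t)"
    and above: "\<And>t. t \<in> {\<alpha><..<\<omega>} \<Longrightarrow> V (q t) > c"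
    and en: "\<And>t. t \<in> {\<alpha><..<\<omega>} \<Longrightarrow> G \<phi> (norm (v t)) = V (q t) - c"
    and lim: "((\<lambda>t. infdist (q t) Vm) \<longlongrightarrow> 0) (at_right \<alpha>)"
      "((\<lambda>t. infdist (q t) Vp) \<longlongrightarrow> 0) (at_left \<omega>)"
    \<comment> \<open>Since the contact times are finite, the limits in \<open>ereal\<close> become
      one-sided limits on the real line.\<close>
    using conn
      ereal_tendsto_simps1(2)[of "\<lambda>t. infdist (q t) Vm" 0 \<alpha>]
      ereal_tendsto_simps1(1)[of "\<lambda>t. infdist (q t) Vp" 0 \<omega>] contact
    by (auto simp: c_connection_def Let_def C1_on_def v_def energy_def comp_def algebra_simps)
  have q_deriv: "(q has_vector_derivative v t) (at t within {\<alpha>..\<omega>})" if "t \<in> {\<alpha>..\<omega>}" for t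
    using q_diff that
    by (simp add: v_def velocity_def differentiable_on_def flip: vector_derivative_works)
  have q_cont: "continuous_on {\<alpha>..\<omega>} q" using q_diff by (rule differentiable_imp_continuous_on)
  have V_cont: "continuous_on UNIV V" by (rule C1_potential_continuous[OF V_C1])
  have closed: "closed (Vm \<union> Vp)"
    unfolding sublevel[symmetric] by (intro closed_Collect_le V_cont continuous_intros)

  \<comment> \<open>Both ends are treated at once: \<open>F\<close> stands for the one-sided
    neighbourhood filter inside the interval, and \<open>A\<close>, \<open>B\<close> for
    \<open>Vm\<close>, \<open>Vp\<close> in either order.\<close>
  have contact_point: "q t \<in> A" "V (q t) = c" "v t = 0"
    if A: "A \<union> B = Vm \<union> Vp" "setdist A B > 0" and F: "F \<noteq> bot" "F \<le> at t within {\<alpha>..\<omega>}"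
      "\<forall>\<^sub>F s in F. s \<in> {\<alpha><..<\<omega>}" and t: "t \<in> {\<alpha>..\<omega>}"
      and lim: "((\<lambda>t. infdist (q t) A) \<longlongrightarrow> 0) F" for t A B F
  proof -
    have q_lim: "(q \<longlongrightarrow> q t) F" and v_lim: "(v \<longlongrightarrow> v t) F"
      using q_cont v_cont t F(2) by (auto simp: continuous_on_def intro: tendsto_mono)
    show "q t \<in> A"
      by (rule mem_of_infdist_tendsto_zero[OF _ A(2) lim q_lim F(1)]) (use closed A(1) in simp)
    then have le: "V (q t) \<le> c" using A(1) sublevel by auto
    have V_lim: "((\<lambda>s. V (q s)) \<longlongrightarrow> V (q t)) F"
      using V_cont q_lim by (auto simp: continuous_on_eq_continuous_at intro: isCont_tendsto_compose)
    have "c \<le> V (q t)"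
      by (rule tendsto_lowerbound[OF V_lim eventually_mono[OF F(3)] F(1)]) (use above in force)
    with le show eq: "V (q t) = c" by simp
    \<comment> \<open>By the energy identity this is the limit of \<open>G\<close> of the speed,
      which forces zero velocity at the contact time.\<close>
    have "((\<lambda>s. V (q s) - c) \<longlongrightarrow> 0) F" using tendsto_diff[OF V_lim tendsto_const[of c]] eq by simp
    then have "((\<lambda>s. G \<phi> (norm (v s))) \<longlongrightarrow> 0) F"
      by (rule Lim_transform_eventually) (use F(3) en in \<open>auto elim: eventually_mono\<close>)
    then show "v t = 0" by (rule eq_zero_of_G_tendsto_zero[OF v_lim _ F(1)])
  qed
  have at_\<alpha>: "q \<alpha> \<in> Vm" "V (q \<alpha>) = c" "v \<alpha> = 0"
    using contact_point[of Vm Vp "at_right \<alpha>" \<alpha>] separated lim contact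
    by (auto simp: eventually_at_right_field intro!: at_le exI[of _ \<omega>] simp: at_within_Icc_at_right)
  have at_\<omega>: "q \<omega> \<in> Vp" "V (q \<omega>) = c" "v \<omega> = 0"
    using contact_point[of Vp Vm "at_left \<omega>" \<omega>] separated lim contact
    by (auto simp: setdist_sym Un_commute eventually_at_left_field at_within_Icc_at_left
        intro!: exI[of _ \<alpha>])

  \<comment> \<open>The reflected curve and its velocity\<close>
  define qc where "qc = (\<lambda>t. q (?\<rho> t))"
  define w where "w = (\<lambda>t. ?\<sigma> t *\<^sub>R v (?\<rho> t))"
  have \<rho>_in: "?\<rho> t \<in> {\<alpha>..\<omega>}" for t by (rule reflect_in[OF contact])
  have corner: "v (?\<rho> t) = 0 \<and> V (q (?\<rho> t)) = c" if "?\<sigma> t = 0" for t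
    by (rule reflect_sign_cases[OF contact, of t]) (use that at_\<alpha> at_\<omega> in auto)
  have interior: "?\<rho> t \<in> {\<alpha><..<\<omega>}" "\<bar>?\<sigma> t\<bar> = 1" if "?\<sigma> t \<noteq> 0" for t
    by (rule reflect_sign_cases[OF contact, of t]; use that in simp)+
  have qc_deriv: "(qc has_vector_derivative w t) (at t)" for t
  proof (cases "?\<sigma> t = 0")
    case True
    then show ?thesis
      using reflect_comp_has_vector_derivative_corner[OF contact True, of q] q_deriv[OF \<rho>_in, of t]
        corner[OF True] by (simp add: qc_def w_def)
  next
    case False
    then have "(q has_vector_derivative v (?\<rho> t)) (at (?\<rho> t))"
      using q_deriv[OF \<rho>_in, of t] interior(1)[OF False] by (simp add: at_within_Icc_at)
    then show ?thesis
      using reflect_comp_has_vector_derivative[OF contact False] by (simp add: qc_def w_def)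
  qed
  then have vel: "velocity UNIV qc = w" by (auto simp: velocity_def vector_derivative_at)
  have w_cont: "continuous_on UNIV w"
    unfolding w_def by (rule continuous_reflect_sign_scaleR[OF contact v_cont at_\<alpha>(3) at_\<omega>(3)])
  have qc_diff: "qc differentiable_on UNIV"
    using qc_deriv by (auto simp: differentiable_on_def intro: differentiableI_vector)
  have "weak_solution \<phi> V qc"
  proof (rule weak_solution_of_flux_derivative[where S = "{t. ?\<sigma> t = 0}"])
    show "continuous_on UNIV (\<lambda>t. flux \<phi> (velocity UNIV qc t))"
      unfolding vel by (rule continuous_on_compose2[OF continuous_flux w_cont]) simp
    show "continuous_on UNIV (\<lambda>t. grad V (qc t))"
      using V_C1 differentiable_imp_continuous_on[OF qc_diff]
      by (auto simp: C1_potential_def intro: continuous_on_compose2)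
    show "finite ({a..b} \<inter> {t. ?\<sigma> t = 0})" for a b
      using finite_reflect_corners[OF contact, of a b] by (simp add: Int_def)
    fix t assume "t \<notin> {t. ?\<sigma> t = 0}"
    then have \<sigma>: "?\<sigma> t \<noteq> 0" by simp
    \<comment> \<open>The sign occurs twice, once from oddness of the flux and once from the chain
      rule; its square is 1, which is the invariance under time reversal.\<close>
    have "((\<lambda>s. ?\<sigma> t *\<^sub>R flux \<phi> (v (?\<rho> s))) has_vector_derivative
        ?\<sigma> t *\<^sub>R ?\<sigma> t *\<^sub>R grad V (q (?\<rho> t))) (at t)"
      using flux[OF interior(1)[OF \<sigma>]]
      by (intro bounded_linear.has_vector_derivative[OF bounded_linear_scaleR_right]
          reflect_comp_has_vector_derivative[OF contact \<sigma>, where f = "\<lambda>s. flux \<phi> (v s)"])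
    moreover have "?\<sigma> t *\<^sub>R ?\<sigma> t *\<^sub>R grad V (q (?\<rho> t)) = grad V (qc t)"
      using interior(2)[OF \<sigma>] by (simp add: qc_def abs_if split: if_splits)
    \<comment> \<open>Near \<open>t\<close> the sign is frozen at 1 or -1, so it leaves the norm
      unchanged and can be pulled out of the flux.\<close>
    moreover have "\<forall>\<^sub>F s in nhds t. flux \<phi> (w s) = ?\<sigma> t *\<^sub>R flux \<phi> (v (?\<rho> s))"
      using eventually_reflect_sign[OF contact \<sigma>]
      by eventually_elim (use interior(2)[OF \<sigma>] in \<open>simp add: w_def flux_def\<close>)
    ultimately show "((\<lambda>t. flux \<phi> (velocity UNIV qc t)) has_vector_derivative grad V (qc t)) (at t)"
      unfolding vel by (subst has_vector_derivative_cong_ev)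
        (auto elim: eventually_mono dest: eventually_nhds_x_imp_x)
  qed
  moreover have "C1_on UNIV qc" using qc_diff w_cont by (simp add: C1_on_def vel)
  moreover have "energy \<phi> V UNIV qc t = - c" for t
  proof (cases "?\<sigma> t = 0")
    \<comment> \<open>At a corner the speed is 0 and \<open>V = c\<close>, so the energy is -c by
      the convention \<open>G \<phi> 0 = 0\<close>.\<close>
    case True
    with corner show ?thesis unfolding energy_def vel by (simp add: w_def qc_def G_def)
  next
    case False
    then show ?thesis
      using interior[OF False] en[of "?\<rho> t"] unfolding energy_def vel by (simp add: w_def qc_def)
  qed
  moreover have eq: "qc t = q t" if "t \<in> {\<alpha>..\<omega>}" for t
    using that by (simp add: qc_def reflect_of_mem[OF contact])
  moreover have "velocity UNIV qc \<alpha> = 0" "velocity UNIV qc \<omega> = 0"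
    using contact at_\<alpha>(3) at_\<omega>(3) by (simp_all add: vel w_def reflect_of_mem[OF contact])
  moreover have "qc (t + 2 * (\<omega> - \<alpha>)) = qc t" "qc (\<alpha> - t) = qc (\<alpha> + t)" "qc (\<omega> - t) = qc (\<omega> + t)" for t
    unfolding qc_def by (simp_all only: reflect_periodic[OF contact] reflect_left reflect_right[OF contact])
  ultimately show ?thesis
    using at_\<alpha> at_\<omega> above contact by (intro exI[of _ qc]) auto
qed

end
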